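(* Let $X$ be a function lattice over a metric measure space $(\mathcal P,d,\mu)$. If $X$ is a Banach function lattice, then the functional $\|\cdot\|_{N^1X}$ is a seminorm on $N^1X$ and a norm on $\widetilde N^1X$. If $X$ is just a quasi-Banach function lattice, then $\|\cdot\|_{N^1X}$ is a quasi-seminorm on $N^1X$ and a quasi-norm on $\widetilde N^1X$. Moreover, the modulus of concavity remains the same as in $X$, i.e., if $c\ge1$ is the modulus of concavity of $X$, then $\|u+v\|_{N^1X}\le c(\|u\|_{N^1X}+\|v\|_{N^1X})$ for all $u,v\in N^1X$.
   Context: Standing setting: $(\mathcal P,d)$ is a metric space with a $\sigma$-finite Borel regular measure $\mu$ (Borel sets are $\mu$-measurable, and each $\mu$-measurable set $A$ is contained in a Borel set $D$ with $\mu(D)=\mu(A)$), such that every ball has finite positive measure. $\mathcal M(\mathcal P,\mu)$ is the set of extended real-valued $\mu$-measurable functions on $\mathcal P$ (defined everywhere). A quasi-Banach function lattice $X$ is given by a functional $\|\cdot\|_X:\mathcal M(\mathcal P,\mu)\to[0,\infty]$ with $X=\{u\in\mathcal M(\mathcal P,\mu):\|u\|_X<\infty\}$ such that, for some constant $c\ge1$ (the modulus of concavity): (i) $\|u\|_X=0$ iff $u=0$ a.e.; $\|au\|_X=|a|\,\|u\|_X$ for $a\in\mathbb R$; $\|u+v\|_X\le c(\|u\|_X+\|v\|_X)$; (ii) $|u|\le|v|$ a.e. implies $\|u\|_X\le\|v\|_X$; (iii) (Riesz–Fischer) if $u_n\ge0$ a.e. for all $n\ge 1$, then $\bigl\|\sum_{n=1}^\infty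 u_n\bigr\|_X\le\sum_{n=1}^\infty c^n\|u_n\|_X$. Moreover, $\|\cdot\|_X$ is assumed continuous: $\|u_n-u\|_X\to0$ implies $\|u_n\|_X\to\|u\|_X$. Elements of $X$ are functions defined everywhere, not a.e. equivalence classes. $X$ is a Banach function lattice if $c=1$. A curve is a non-constant rectifiable continuous map from a compact interval to $\mathcal P$, always parametrized by arc length, $\gamma:[0,l_\gamma]\to\mathcal P$. A Borel function $g:\mathcal P\to[0,\infty]$ is an upper gradient of $u:\mathcal P\to\overline{\mathbb R}=\mathbb{R}\cup\{\pm\infty\}$ if $|u(\gamma(0))-u(\gamma(l_\gamma))|\le\int_\gamma g\,ds$ for all curves $\gamma$, with the convention $|(\pm\infty)-(\pm\infty)|=\infty$ in this inequality. For $u\in\mathcal M(\mathcal P,\mu)$, $\|u\|_{N^1X}=\|u\|_X+\inf_g\|g\|_X$, the infimum being over all upper gradients $g$ of $u$; $N^1X=\{u\in\mathcal M(\mathcal P,\mu):\|u\|_{N^1X}<\infty\}$ (functions defined everywhere), and $\widetilde N^1X=N^1X/\!\sim$, where $u\sim v$ iff $\|u-v\|_{N^1X}=0$. When forming linear combinations of functions pointwise, the value at points where the expression is of the form $\infty-\infty$ is taken to be $0$. *)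

theory Defs
  imports "HOL-Analysis.Analysis"
begin

section \<open>Metric measure spaces\<close>

text \<open>The metric space is the whole type \<open>'a\<close>. The measure need not be complete.\<close>

locale metric_measure_space = sigma_finite_measure M
  for M :: "'a::metric_space measure" +
  assumes space_UNIV: "space M = UNIV"
    and borel_measurable_sets: "sets borel \<subseteq> sets M"
    and borel_regular:
      "\<And>A. A \<in> sets M \<Longrightarrow> \<exists>D\<in>sets borel. A \<subseteq> D \<and> emeasure M D = emeasure M A"
    and ball_pos: "\<And>x r. 0 < r \<Longrightarrow> 0 < emeasure M (ball x r)"
    and ball_finite: "\<And>x r. 0 < r \<Longrightarrow> emeasure M (ball x r) < \<infinity>"

section \<open>Pointwise linear combinations of extended real-valued functions\<close>

text \<open>
  Addition of extended reals with the convention \<open>\<infinity> - \<infinity> = 0\<close>; the library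
  has \<open>\<infinity> + (-\<infinity>) = \<infinity>\<close> on \<open>ereal\<close>. In scalar multiples, \<open>0 * \<infinity> = 0\<close>
  as in the library.
\<close>

definition ext_add :: "ereal \<Rightarrow> ereal \<Rightarrow> ereal" where
  "ext_add a b = (if a = \<infinity> \<and> b = -\<infinity> \<or> a = -\<infinity> \<and> b = \<infinity> then 0 else a + b)"

definition fun_add :: "('a \<Rightarrow> ereal) \<Rightarrow> ('a \<Rightarrow> ereal) \<Rightarrow> 'a \<Rightarrow> ereal" where
  "fun_add u v = (\<lambda>x. ext_add (u x) (v x))"

definition fun_scale :: "real \<Rightarrow> ('a \<Rightarrow> ereal) \<Rightarrow> 'a \<Rightarrow> ereal" where
  "fun_scale a u = (\<lambda>x. ereal a * u x)"

definition fun_diff :: "('a \<Rightarrow> ereal) \<Rightarrow> ('a \<Rightarrow> ereal) \<Rightarrow> 'a \<Rightarrow> ereal" where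
  "fun_diff u v = fun_add u (fun_scale (-1) v)"

section \<open>Quasi-Banach function lattices\<close>

text \<open>
  \<open>N\<close> is the functional of the lattice; only its values on \<open>borel_measurable M\<close> are relevant.
  In \<open>riesz_fischer\<close> the sequence is indexed from \<open>0\<close>, so \<open>u n\<close> is the function usually
  written with index \<open>n + 1\<close>. The sum of the series is only determined almost everywhere,
  since the terms are only nonnegative almost everywhere; \<open>s\<close> is any
  measurable function that equals it almost everywhere.
\<close>

locale quasi_banach_function_lattice = metric_measure_space M
  for M :: "'a::metric_space measure" +
  fixes N :: "('a \<Rightarrow> ereal) \<Rightarrow> ennreal" and c :: real
  assumes modulus_ge_1: "1 \<le> c"
    and N_eq_0_iff: "\<And>u. u \<in> borel_measurable M \<Longrightarrow> N u = 0 \<longleftrightarrow> (AE x in M. u x = 0)"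
    and N_scale: "\<And>a u. u \<in> borel_measurable M \<Longrightarrow> N (fun_scale a u) = ennreal \<bar>a\<bar> * N u"
    and N_add: "\<And>u v. u \<in> borel_measurable M \<Longrightarrow> v \<in> borel_measurable M \<Longrightarrow>
        N (fun_add u v) \<le> ennreal c * (N u + N v)"
    and N_mono: "\<And>u v. u \<in> borel_measurable M \<Longrightarrow> v \<in> borel_measurable M \<Longrightarrow>
        (AE x in M. \<bar>u x\<bar> \<le> \<bar>v x\<bar>) \<Longrightarrow> N u \<le> N v"
    and riesz_fischer: "\<And>u s. (\<And>n. u n \<in> borel_measurable M) \<Longrightarrow> s \<in> borel_measurable M \<Longrightarrow>
        (\<And>n. AE x in M. 0 \<le> u n x) \<Longrightarrow> (AE x in M. (\<lambda>n. u n x) sums s x) \<Longrightarrow>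
        N s \<le> (\<Sum>n::nat. ennreal (c ^ Suc n) * N (u n))"
    and N_continuous: "\<And>u v. (\<And>n. u n \<in> borel_measurable M) \<Longrightarrow> v \<in> borel_measurable M \<Longrightarrow>
        (\<lambda>n. N (fun_diff (u n) v)) \<longlonglongrightarrow> 0 \<Longrightarrow> (\<lambda>n::nat. N (u n)) \<longlonglongrightarrow> N v"

section \<open>Curves and upper gradients\<close>

definition curve_length :: "(real \<Rightarrow> 'a::metric_space) \<Rightarrow> real \<Rightarrow> real \<Rightarrow> ennreal" where
  "curve_length \<gamma> a b =
    (SUP (n, t) \<in> {(n::nat, t). t 0 = a \<and> t n = b \<and> (\<forall>i<n. t i \<le> t (Suc i))}.
      \<Sum>i<n. ennreal (dist (\<gamma> (t i)) (\<gamma> (t (Suc i)))))"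

text \<open>
  A non-constant continuous curve on \<open>{0..l}\<close> parametrized by arc length. Rectifiability
  is the case \<open>t = l\<close> of the last clause.
\<close>

definition arc_length_curve :: "real \<Rightarrow> (real \<Rightarrow> 'a::metric_space) \<Rightarrow> bool" where
  "arc_length_curve l \<gamma> \<longleftrightarrow>
    continuous_on {0..l} \<gamma> \<and>
    (\<exists>s\<in>{0..l}. \<exists>t\<in>{0..l}. \<gamma> s \<noteq> \<gamma> t) \<and>
    (\<forall>t\<in>{0..l}. curve_length \<gamma> 0 t = ennreal t)"

definition curve_integral :: "('a \<Rightarrow> ennreal) \<Rightarrow> real \<Rightarrow> (real \<Rightarrow> 'a) \<Rightarrow> ennreal" where
  "curve_integral g l \<gamma> = (\<integral>\<^sup>+ t\<in>{0..l}. g (\<gamma> t) \<partial>lborel)"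

text \<open>The distance \<open>\<bar>a - b\<bar>\<close> with the convention \<open>\<bar>(\<plusminus>\<infinity>) - (\<plusminus>\<infinity>)\<bar> = \<infinity>\<close>.\<close>

definition ext_dist :: "ereal \<Rightarrow> ereal \<Rightarrow> ennreal" where
  "ext_dist a b = (if \<bar>a\<bar> = \<infinity> \<and> \<bar>b\<bar> = \<infinity> then \<infinity> else e2ennreal \<bar>a - b\<bar>)"

definition upper_gradient :: "('a::metric_space \<Rightarrow> ennreal) \<Rightarrow> ('a \<Rightarrow> ereal) \<Rightarrow> bool" where
  "upper_gradient g u \<longleftrightarrow> g \<in> borel_measurable borel \<and>
    (\<forall>l \<gamma>. arc_length_curve l \<gamma> \<longrightarrow> ext_dist (u (\<gamma> 0)) (u (\<gamma> l)) \<le> curve_integral g l \<gamma>)"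

section \<open>The Newtonian space\<close>

definition N1_norm :: "(('a::metric_space \<Rightarrow> ereal) \<Rightarrow> ennreal) \<Rightarrow> ('a \<Rightarrow> ereal) \<Rightarrow> ennreal" where
  "N1_norm N u = N u + (INF g \<in> {g. upper_gradient g u}. N (\<lambda>x. enn2ereal (g x)))"

definition N1_space ::
  "'a::metric_space measure \<Rightarrow> (('a \<Rightarrow> ereal) \<Rightarrow> ennreal) \<Rightarrow> ('a \<Rightarrow> ereal) set" where
  "N1_space M N = {u \<in> borel_measurable M. N1_norm N u < \<infinity>}"

definition N1_rel ::
  "'a::metric_space measure \<Rightarrow> (('a \<Rightarrow> ereal) \<Rightarrow> ennreal) \<Rightarrow> (('a \<Rightarrow> ereal) \<times> ('a \<Rightarrow> ereal)) set" where
  "N1_rel M N =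
    {(u, v). u \<in> N1_space M N \<and> v \<in> N1_space M N \<and> N1_norm N (fun_diff u v) = 0}"

definition N1_class ::
  "'a::metric_space measure \<Rightarrow> (('a \<Rightarrow> ereal) \<Rightarrow> ennreal) \<Rightarrow> ('a \<Rightarrow> ereal) \<Rightarrow> ('a \<Rightarrow> ereal) set" where
  "N1_class M N u = N1_rel M N `` {u}"

definition N1_quotient ::
  "'a::metric_space measure \<Rightarrow> (('a \<Rightarrow> ereal) \<Rightarrow> ennreal) \<Rightarrow> ('a \<Rightarrow> ereal) set set" where
  "N1_quotient M N = N1_space M N // N1_rel M N"

text \<open>
  The operations on classes, through arbitrary representatives. They are meaningful
  only if the operations on functions respect the relation.
\<close>

definition N1_quotient_add ::
  "'a::metric_space measure \<Rightarrow> (('a \<Rightarrow> ereal) \<Rightarrow> ennreal) \<Rightarrow>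
    ('a \<Rightarrow> ereal) set \<Rightarrow> ('a \<Rightarrow> ereal) set \<Rightarrow> ('a \<Rightarrow> ereal) set" where
  "N1_quotient_add M N U V = (\<Union>u\<in>U. \<Union>v\<in>V. N1_class M N (fun_add u v))"

definition N1_quotient_scale ::
  "'a::metric_space measure \<Rightarrow> (('a \<Rightarrow> ereal) \<Rightarrow> ennreal) \<Rightarrow>
    real \<Rightarrow> ('a \<Rightarrow> ereal) set \<Rightarrow> ('a \<Rightarrow> ereal) set" where
  "N1_quotient_scale M N a U = (\<Union>u\<in>U. N1_class M N (fun_scale a u))"

definition N1_quotient_norm ::
  "(('a::metric_space \<Rightarrow> ereal) \<Rightarrow> ennreal) \<Rightarrow> ('a \<Rightarrow> ereal) set \<Rightarrow> ennreal" where
  "N1_quotient_norm N U = the_elem (N1_norm N ` U)"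

section \<open>Seminorms and norms on carrier sets\<close>

definition real_vector_space_on ::
  "'v set \<Rightarrow> ('v \<Rightarrow> 'v \<Rightarrow> 'v) \<Rightarrow> (real \<Rightarrow> 'v \<Rightarrow> 'v) \<Rightarrow> 'v \<Rightarrow> bool" where
  "real_vector_space_on V add smul zero \<longleftrightarrow>
    zero \<in> V \<and>
    (\<forall>x\<in>V. \<forall>y\<in>V. add x y \<in> V) \<and>
    (\<forall>a. \<forall>x\<in>V. smul a x \<in> V) \<and>
    (\<forall>x\<in>V. \<forall>y\<in>V. \<forall>z\<in>V. add (add x y) z = add x (add y z)) \<and>
    (\<forall>x\<in>V. \<forall>y\<in>V. add x y = add y x) \<and>
    (\<forall>x\<in>V. add zero x = x) \<and>
    (\<forall>x\<in>V. \<exists>y\<in>V. add x y = zero) \<and>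
    (\<forall>a. \<forall>x\<in>V. \<forall>y\<in>V. smul a (add x y) = add (smul a x) (smul a y)) \<and>
    (\<forall>a b. \<forall>x\<in>V. smul (a + b) x = add (smul a x) (smul b x)) \<and>
    (\<forall>a b. \<forall>x\<in>V. smul (a * b) x = smul a (smul b x)) \<and>
    (\<forall>x\<in>V. smul 1 x = x)"

text \<open>
  For seminorms only closure under the operations is required of the carrier, not the
  vector space axioms: with \<open>\<infinity> - \<infinity> = 0\<close>, pointwise addition of everywhere defined
  extended real-valued functions is not associative. For norms the carrier
  has to be a vector space. The number \<open>C\<close> is the modulus of concavity.
\<close>

definition quasi_seminorm_on ::
  "real \<Rightarrow> 'v set \<Rightarrow> ('v \<Rightarrow> 'v \<Rightarrow> 'v) \<Rightarrow> (real \<Rightarrow> 'v \<Rightarrow> 'v) \<Rightarrow> ('v \<Rightarrow> ennreal) \<Rightarrow> bool" where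
  "quasi_seminorm_on C V add smul p \<longleftrightarrow>
    1 \<le> C \<and>
    (\<forall>x\<in>V. \<forall>y\<in>V. add x y \<in> V) \<and>
    (\<forall>a. \<forall>x\<in>V. smul a x \<in> V) \<and>
    (\<forall>x\<in>V. p x < \<infinity>) \<and>
    (\<forall>a. \<forall>x\<in>V. p (smul a x) = ennreal \<bar>a\<bar> * p x) \<and>
    (\<forall>x\<in>V. \<forall>y\<in>V. p (add x y) \<le> ennreal C * (p x + p y))"

definition quasi_norm_on ::
  "real \<Rightarrow> 'v set \<Rightarrow> ('v \<Rightarrow> 'v \<Rightarrow> 'v) \<Rightarrow> (real \<Rightarrow> 'v \<Rightarrow> 'v) \<Rightarrow> 'v \<Rightarrow> ('v \<Rightarrow> ennreal) \<Rightarrow> bool" where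
  "quasi_norm_on C V add smul zero p \<longleftrightarrow>
    real_vector_space_on V add smul zero \<and>
    quasi_seminorm_on C V add smul p \<and>
    (\<forall>x\<in>V. p x = 0 \<longleftrightarrow> x = zero)"

abbreviation seminorm_on ::
  "'v set \<Rightarrow> ('v \<Rightarrow> 'v \<Rightarrow> 'v) \<Rightarrow> (real \<Rightarrow> 'v \<Rightarrow> 'v) \<Rightarrow> ('v \<Rightarrow> ennreal) \<Rightarrow> bool" where
  "seminorm_on \<equiv> quasi_seminorm_on 1"

abbreviation norm_on ::
  "'v set \<Rightarrow> ('v \<Rightarrow> 'v \<Rightarrow> 'v) \<Rightarrow> (real \<Rightarrow> 'v \<Rightarrow> 'v) \<Rightarrow> 'v \<Rightarrow> ('v \<Rightarrow> ennreal) \<Rightarrow> bool" where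
  "norm_on \<equiv> quasi_norm_on 1"

end

theory Submission
  imports Defs
begin

text \<open>
  The sum of upper gradients of \<open>u\<close> and \<open>v\<close> is an upper gradient of \<open>u + v\<close>: a curve with an end
  at which \<open>u\<close> or \<open>v\<close> is infinite has infinite integral, and otherwise the triangle inequality in
  \<open>\<real>\<close> applies. The identities of a vector space, and the compatibility of the equivalence relation
  with addition, hold only where the functions are finite. If \<open>g\<close> is an upper gradient
  of \<open>u\<close> in the lattice, then adding \<open>g / n\<close> to an upper gradient makes the values on \<open>{\<bar>u\<bar> = \<infinity>}\<close>
  irrelevant, at a cost that vanishes in the limit; since \<open>\<bar>u\<bar> < \<infinity>\<close> almost everywhere as well,
  changing a function on such a set does not affect its Newtonian norm.
\<close>

subsection \<open>Arithmetic of extended reals\<close>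

text \<open>With one infinite argument the ordinary difference is already infinite; with two, the
  convention applies. An infinite value at an end of a curve therefore forces an infinite integral
  of every upper gradient.\<close>

lemma ext_dist_infinite: "\<bar>a\<bar> = \<infinity> \<or> \<bar>b\<bar> = \<infinity> \<Longrightarrow> ext_dist a b = \<infinity>"
  by (cases a; cases b) (auto simp: ext_dist_def e2ennreal_infty)

lemma ext_dist_ereal [simp]: "ext_dist (ereal a) (ereal b) = ennreal \<bar>a - b\<bar>"
  by (simp add: ext_dist_def ennreal.rep_eq flip: ennreal.abs_eq)

text \<open>As soon as one of the four values is infinite, the right side is \<infinity>, so the
  value 0 that \<open>ext_add\<close> gives to \<infinity> - \<infinity> does no harm.\<close>

lemma ext_dist_add: "ext_dist (ext_add a b) (ext_add a' b') \<le> ext_dist a a' + ext_dist b b'"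
proof (cases "\<bar>a\<bar> = \<infinity> \<or> \<bar>a'\<bar> = \<infinity> \<or> \<bar>b\<bar> = \<infinity> \<or> \<bar>b'\<bar> = \<infinity>")
  case True
  then show ?thesis
    by (auto simp: ext_dist_infinite)
next
  case False
  then obtain x x' y y' where "a = ereal x" "a' = ereal x'" "b = ereal y" "b' = ereal y'"
    by (metis ereal_infinity_cases abs_ereal.simps(2,3) ereal_cases)
  then show ?thesis
    by (simp add: ext_add_def flip: ennreal_plus)
qed

lemma ext_dist_scale: "ext_dist (ereal r * a) (ereal r * b) \<le> ennreal \<bar>r\<bar> * ext_dist a b"
proof (cases "\<bar>a\<bar> = \<infinity> \<or> \<bar>b\<bar> = \<infinity>")
  case True
  \<comment> \<open>This settles \<open>r = 0\<close>: by \<open>0 * \<infinity> = 0\<close> both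
    sides vanish.\<close>
  moreover have "ext_dist 0 0 = 0"
    using ext_dist_ereal[of 0 0] by (simp add: zero_ereal_def)
  ultimately show ?thesis
    by (cases "r = 0") (auto simp: ext_dist_infinite ennreal_mult_top simp flip: zero_ereal_def)
next
  case False
  then obtain x y where "a = ereal x" "b = ereal y"
    by (metis abs_ereal.simps(2,3) ereal_cases)
  then show ?thesis
    by (simp flip: ennreal_mult abs_mult right_diff_distrib)
qed

lemma enn2ereal_ennreal_mult: "0 \<le> r \<Longrightarrow> enn2ereal (ennreal r * a) = ereal r * enn2ereal a"
  by (simp add: times_ennreal.rep_eq enn2ereal_ennreal)

lemma fun_add_enn2ereal:
  "fun_add (\<lambda>x. enn2ereal (g x)) (\<lambda>x. enn2ereal (h x)) = (\<lambda>x. enn2ereal (g x + h x))"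
proof -
  \<comment> \<open>Without -\<infinity> the special clause of \<open>ext_add\<close> never
    applies.\<close>
  have "enn2ereal a \<noteq> -\<infinity>" for a
    using enn2ereal_nonneg[of a] by auto
  then show ?thesis
    by (simp add: fun_add_def ext_add_def plus_ennreal.rep_eq)
qed

lemma fun_scale_enn2ereal:
  "0 \<le> r \<Longrightarrow> fun_scale r (\<lambda>x. enn2ereal (g x)) = (\<lambda>x. enn2ereal (ennreal r * g x))"
  by (simp add: fun_scale_def enn2ereal_ennreal_mult)

text \<open>Where \<open>h x = \<infinity>\<close> the difference is 0 by convention; elsewhere it
  is exactly \<open>k x\<close>. Continuity of \<open>N\<close> thus applies to perturbations of
  \<open>h\<close> even if \<open>h\<close> takes infinite values.\<close>

lemma abs_diff_enn2ereal_le: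
  "\<bar>fun_diff (\<lambda>x. enn2ereal (h x + k x)) (\<lambda>x. enn2ereal (h x)) x\<bar> \<le> \<bar>enn2ereal (k x)\<bar>"
  by (cases "h x"; cases "k x")
     (auto simp: fun_diff_def fun_add_def fun_scale_def ext_add_def plus_ennreal.rep_eq
        enn2ereal_ennreal)

lemma fun_diff_self: "fun_diff u u = (\<lambda>x. 0)"
proof
  show "fun_diff u u x = 0" for x
    by (cases "u x") (auto simp: fun_diff_def fun_add_def fun_scale_def ext_add_def zero_ereal_def)
qed

text \<open>For \<open>a \<noteq> 0\<close> the two sides meet \<infinity> - \<infinity> at the same
  points, and for \<open>a = 0\<close> both vanish. Scaling is thus compatible with differences
  everywhere, not just off an exceptional set.\<close>

lemma fun_scale_diff: "fun_diff (fun_scale a u) (fun_scale a v) = fun_scale a (fun_diff u v)"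
proof
  show "fun_diff (fun_scale a u) (fun_scale a v) x = fun_scale a (fun_diff u v) x" for x
    by (cases "u x"; cases "v x"; cases "a = 0"; cases "a > 0")
       (auto simp: fun_diff_def fun_add_def fun_scale_def ext_add_def algebra_simps
          zero_ereal_def[symmetric])
qed

lemma fun_diff_zero: "fun_diff u (\<lambda>x. 0) = u"
  by (simp add: fun_diff_def fun_add_def fun_scale_def ext_add_def)

lemma fun_diff_swap: "fun_scale (- 1) (fun_diff u v) = fun_diff v u"
proof
  show "fun_scale (- 1) (fun_diff u v) x = fun_diff v u x" for x
    by (cases "u x"; cases "v x") (auto simp: fun_diff_def fun_add_def fun_scale_def ext_add_def)
qed

lemma fun_add_commute: "fun_add u v = fun_add v u"
  by (auto simp: fun_add_def ext_add_def add.commute)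

lemma fun_scale_scale: "fun_scale a (fun_scale b u) = fun_scale (a * b) u"
  by (auto simp: fun_scale_def mult.assoc[symmetric])

lemma fun_scale_one: "fun_scale 1 u = u"
  by (simp add: fun_scale_def)

lemma fun_scale_zero: "fun_scale 0 u = (\<lambda>x. 0)"
  by (simp add: fun_scale_def zero_ereal_def[symmetric])

lemma measurable_fun_scale [measurable]:
  "u \<in> borel_measurable M \<Longrightarrow> fun_scale a u \<in> borel_measurable M"
  unfolding fun_scale_def by measurable

lemma measurable_fun_add [measurable]:
  assumes [measurable]: "u \<in> borel_measurable M" "v \<in> borel_measurable M"
  shows "fun_add u v \<in> borel_measurable M"
  unfolding fun_add_def ext_add_def by measurable

lemma measurable_fun_diff [measurable]:
  assumes [measurable]: "u \<in> borel_measurable M" "v \<in> borel_measurable M"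
  shows "fun_diff u v \<in> borel_measurable M"
  unfolding fun_diff_def by measurable

subsection \<open>Curve integrals and upper gradients\<close>

text \<open>A curve is arbitrary outside \<open>{0..l}\<close>, so measurability along it is
  available only on the restricted space.\<close>

lemma measurable_along_curve:
  assumes "arc_length_curve l \<gamma>" and "g \<in> borel_measurable borel"
  shows "(\<lambda>t. g (\<gamma> t)) \<in> borel_measurable (restrict_space lborel {0..l})"
proof -
  have "\<gamma> \<in> borel_measurable (restrict_space borel {0..l})"
    using assms(1) by (intro borel_measurable_continuous_on_restrict) (simp add: arc_length_curve_def)
  then have "\<gamma> \<in> borel_measurable (restrict_space lborel {0..l})"
    by (simp cong: measurable_cong_sets sets_restrict_space_cong)
  then show ?thesis
    using assms(2) by (rule measurable_compose)
qed

lemma curve_integral_restrict: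
  "curve_integral g l \<gamma> = (\<integral>\<^sup>+ t. g (\<gamma> t) \<partial>restrict_space lborel {0..l})"
  by (simp add: curve_integral_def nn_integral_restrict_space)

lemma curve_integral_add:
  assumes "arc_length_curve l \<gamma>" "g \<in> borel_measurable borel" "h \<in> borel_measurable borel"
  shows "curve_integral (\<lambda>x. g x + h x) l \<gamma> = curve_integral g l \<gamma> + curve_integral h l \<gamma>"
  unfolding curve_integral_restrict
  by (intro nn_integral_add measurable_along_curve assms)

lemma curve_integral_cmult:
  assumes "arc_length_curve l \<gamma>" "g \<in> borel_measurable borel"
  shows "curve_integral (\<lambda>x. k * g x) l \<gamma> = k * curve_integral g l \<gamma>"
  unfolding curve_integral_restrict
  by (intro nn_integral_cmult measurable_along_curve assms)

lemma upper_gradient_add: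
  assumes "upper_gradient g u" "upper_gradient h v"
  shows "upper_gradient (\<lambda>x. g x + h x) (fun_add u v)"
  unfolding upper_gradient_def
proof (intro conjI allI impI)
  show "(\<lambda>x. g x + h x) \<in> borel_measurable borel"
    using assms by (auto simp: upper_gradient_def)
  fix l and \<gamma> :: "real \<Rightarrow> 'a" assume \<gamma>: "arc_length_curve l \<gamma>"
  have "ext_dist (u (\<gamma> 0)) (u (\<gamma> l)) + ext_dist (v (\<gamma> 0)) (v (\<gamma> l))
      \<le> curve_integral g l \<gamma> + curve_integral h l \<gamma>"
    using assms \<gamma> by (intro add_mono) (auto simp: upper_gradient_def)
  also have "\<dots> = curve_integral (\<lambda>x. g x + h x) l \<gamma>"
    using assms by (intro curve_integral_add[symmetric] \<gamma>) (auto simp: upper_gradient_def)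
  finally show "ext_dist (fun_add u v (\<gamma> 0)) (fun_add u v (\<gamma> l)) \<le> curve_integral (\<lambda>x. g x + h x) l \<gamma>"
    unfolding fun_add_def by (rule order_trans[OF ext_dist_add])
qed

lemma upper_gradient_scale:
  assumes "upper_gradient g u"
  shows "upper_gradient (\<lambda>x. ennreal \<bar>a\<bar> * g x) (fun_scale a u)"
  unfolding upper_gradient_def
proof (intro conjI allI impI)
  show "(\<lambda>x. ennreal \<bar>a\<bar> * g x) \<in> borel_measurable borel"
    using assms by (auto simp: upper_gradient_def)
  fix l and \<gamma> :: "real \<Rightarrow> 'a" assume \<gamma>: "arc_length_curve l \<gamma>"
  have "ennreal \<bar>a\<bar> * ext_dist (u (\<gamma> 0)) (u (\<gamma> l)) \<le> ennreal \<bar>a\<bar> * curve_integral g l \<gamma>"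
    using assms \<gamma> by (intro mult_left_mono) (auto simp: upper_gradient_def)
  also have "\<dots> = curve_integral (\<lambda>x. ennreal \<bar>a\<bar> * g x) l \<gamma>"
    using assms by (intro curve_integral_cmult[symmetric] \<gamma>) (auto simp: upper_gradient_def)
  finally show "ext_dist (fun_scale a u (\<gamma> 0)) (fun_scale a u (\<gamma> l))
      \<le> curve_integral (\<lambda>x. ennreal \<bar>a\<bar> * g x) l \<gamma>"
    unfolding fun_scale_def by (rule order_trans[OF ext_dist_scale])
qed

lemma upper_gradient_zero: "upper_gradient (\<lambda>x. 0) (\<lambda>x. 0)"
  by (auto simp: upper_gradient_def zero_ereal_def)

section \<open>The Newtonian functional: subadditivity and homogeneity\<close>

context quasi_banach_function_lattice
begin

abbreviation lattice_norm :: "('a \<Rightarrow> ennreal) \<Rightarrow> ennreal" where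
  "lattice_norm g \<equiv> N (\<lambda>x. enn2ereal (g x))"

lemma measurable_enn2ereal_borel:
  assumes "g \<in> borel_measurable borel"
  shows "(\<lambda>x. enn2ereal (g x)) \<in> borel_measurable M"
proof -
  have "g \<in> borel_measurable M"
    using assms borel_measurable_sets
    by (auto simp: measurable_def space_UNIV)
  then show ?thesis
    by measurable
qed

lemma lattice_norm_add:
  assumes "g \<in> borel_measurable borel" "h \<in> borel_measurable borel"
  shows "lattice_norm (\<lambda>x. g x + h x) \<le> ennreal c * (lattice_norm g + lattice_norm h)"
  using N_add[OF assms[THEN measurable_enn2ereal_borel]] by (simp add: fun_add_enn2ereal)

lemma lattice_norm_cmult:
  assumes "g \<in> borel_measurable borel" "0 \<le> r"
  shows "lattice_norm (\<lambda>x. ennreal r * g x) = ennreal r * lattice_norm g"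
  using N_scale[OF assms(1)[THEN measurable_enn2ereal_borel], of r] assms(2)
  by (simp add: fun_scale_enn2ereal)

lemma N_zero: "N (\<lambda>x. 0) = 0"
  by (simp add: N_eq_0_iff)

lemma N1_norm_le: "upper_gradient g u \<Longrightarrow> N1_norm N u \<le> N u + lattice_norm g"
  unfolding N1_norm_def by (intro add_left_mono INF_lower) simp

lemma N1_norm_zero: "N1_norm N (\<lambda>x. 0) = 0"
  using N1_norm_le[OF upper_gradient_zero] by (simp add: N_zero zero_ennreal.rep_eq)

lemma N_le_N1_norm: "N u \<le> N1_norm N u"
  by (simp add: N1_norm_def)

text \<open>The infimum over the empty set is \<infinity>, so a finite Newtonian norm forces some
  upper gradient to lie in the lattice.\<close>

lemma N1_norm_finite_obtain:
  assumes "N1_norm N u < \<infinity>"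
  obtains g where "upper_gradient g u" "lattice_norm g < \<infinity>"
proof -
  have "(INF g \<in> {g. upper_gradient g u}. lattice_norm g) < \<infinity>"
    using assms by (simp add: N1_norm_def)
  then show ?thesis
    using that by (auto simp: INF_less_iff)
qed

text \<open>The infimum need not be attained; estimates for single gradients are carried over to the
  Newtonian norm by a limit along this sequence.\<close>

lemma minimizing_gradients:
  assumes "N1_norm N u < \<infinity>"
  obtains k :: "nat \<Rightarrow> 'a \<Rightarrow> ennreal"
  where "\<And>n. upper_gradient (k n) u" "(\<lambda>n. N u + lattice_norm (k n)) \<longlonglongrightarrow> N1_norm N u"
proof -
  let ?A = "lattice_norm ` {g. upper_gradient g u}"
  have "?A \<noteq> {}"
    using N1_norm_finite_obtain[OF assms] by auto
  then obtain f :: "nat \<Rightarrow> ennreal" where f: "decseq f" "range f \<subseteq> ?A" "Inf ?A = (INF i. f i)"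
    using ennreal_Inf_countable_INF by metis
  have "\<forall>n. \<exists>g. upper_gradient g u \<and> f n = lattice_norm g"
    using f(2) by auto
  then obtain k where k: "\<And>n. upper_gradient (k n) u" "\<And>n. f n = lattice_norm (k n)"
    by metis
  have "(\<lambda>n. lattice_norm (k n)) \<longlonglongrightarrow> Inf ?A"
    using LIMSEQ_INF[OF f(1)] by (simp only: f(3) flip: k(2))
  then have "(\<lambda>n. N u + lattice_norm (k n)) \<longlonglongrightarrow> N1_norm N u"
    unfolding N1_norm_def by (intro tendsto_add tendsto_const)
  with k(1) show ?thesis
    by (rule that)
qed

text \<open>The quasi-triangle inequality is used once for the functions and once for the gradients.
  Both bounds carry the same factor \<open>c\<close>, so their sum does too and the modulus of
  concavity is preserved.\<close>

lemma N1_norm_add: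
  assumes [measurable]: "u \<in> borel_measurable M" "v \<in> borel_measurable M"
    and fin: "N1_norm N u < \<infinity>" "N1_norm N v < \<infinity>"
  shows "N1_norm N (fun_add u v) \<le> ennreal c * (N1_norm N u + N1_norm N v)"
proof -
  obtain g where g: "\<And>n. upper_gradient (g n) u" "(\<lambda>n. N u + lattice_norm (g n)) \<longlonglongrightarrow> N1_norm N u"
    using minimizing_gradients[OF fin(1)] by blast
  obtain h where h: "\<And>n. upper_gradient (h n) v" "(\<lambda>n. N v + lattice_norm (h n)) \<longlonglongrightarrow> N1_norm N v"
    using minimizing_gradients[OF fin(2)] by blast
  have "N1_norm N (fun_add u v) \<le> ennreal c * ((N u + lattice_norm (g n)) + (N v + lattice_norm (h n)))" for n
  proof -
    have "N1_norm N (fun_add u v) \<le> N (fun_add u v) + lattice_norm (\<lambda>x. g n x + h n x)"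
      by (intro N1_norm_le upper_gradient_add g h)
    also have "\<dots> \<le> ennreal c * (N u + N v) + ennreal c * (lattice_norm (g n) + lattice_norm (h n))"
      using g(1)[of n] h(1)[of n]
      by (intro add_mono N_add lattice_norm_add) (auto simp: upper_gradient_def)
    finally show ?thesis
      by (simp add: algebra_simps)
  qed
  moreover have "(\<lambda>n. ennreal c * ((N u + lattice_norm (g n)) + (N v + lattice_norm (h n))))
      \<longlonglongrightarrow> ennreal c * (N1_norm N u + N1_norm N v)"
    by (intro ennreal_tendsto_cmult tendsto_add g(2) h(2)) simp
  ultimately show ?thesis
    by (intro LIMSEQ_le_const) auto
qed

lemma N1_norm_scale_le:
  assumes [measurable]: "u \<in> borel_measurable M" and fin: "N1_norm N u < \<infinity>"
  shows "N1_norm N (fun_scale a u) \<le> ennreal \<bar>a\<bar> * N1_norm N u"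
proof -
  obtain g where g: "\<And>n. upper_gradient (g n) u" "(\<lambda>n. N u + lattice_norm (g n)) \<longlonglongrightarrow> N1_norm N u"
    using minimizing_gradients[OF fin] by blast
  have "N1_norm N (fun_scale a u) \<le> ennreal \<bar>a\<bar> * (N u + lattice_norm (g n))" for n
  proof -
    have "N1_norm N (fun_scale a u) \<le> N (fun_scale a u) + lattice_norm (\<lambda>x. ennreal \<bar>a\<bar> * g n x)"
      by (intro N1_norm_le upper_gradient_scale g)
    also have "\<dots> = ennreal \<bar>a\<bar> * (N u + lattice_norm (g n))"
      using g(1)[of n]
      by (subst lattice_norm_cmult) (auto simp: N_scale algebra_simps upper_gradient_def)
    finally show ?thesis .
  qed
  moreover have "(\<lambda>n. ennreal \<bar>a\<bar> * (N u + lattice_norm (g n))) \<longlonglongrightarrow> ennreal \<bar>a\<bar> * N1_norm N u"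
    by (intro ennreal_tendsto_cmult g(2)) simp
  ultimately show ?thesis
    by (intro LIMSEQ_le_const) auto
qed

text \<open>For \<open>a \<noteq> 0\<close> the reverse inequality is the one-sided bound applied to
  \<open>fun_scale a u\<close> with the factor \<open>1 / a\<close>.\<close>

lemma N1_norm_scale:
  assumes [measurable]: "u \<in> borel_measurable M" and fin: "N1_norm N u < \<infinity>"
  shows "N1_norm N (fun_scale a u) = ennreal \<bar>a\<bar> * N1_norm N u"
proof (cases "a = 0")
  case True
  then show ?thesis
    by (simp add: fun_scale_zero N1_norm_zero)
next
  case False
  have le: "N1_norm N (fun_scale a u) \<le> ennreal \<bar>a\<bar> * N1_norm N u"
    by (intro N1_norm_scale_le assms)
  also have "\<dots> < \<infinity>"
    using fin by (simp add: ennreal_mult_less_top)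
  finally have "N1_norm N (fun_scale (1 / a) (fun_scale a u))
      \<le> ennreal \<bar>1 / a\<bar> * N1_norm N (fun_scale a u)"
    by (intro N1_norm_scale_le) auto
  then have "N1_norm N u \<le> ennreal \<bar>1 / a\<bar> * N1_norm N (fun_scale a u)"
    using False by (simp add: fun_scale_scale fun_scale_one)
  then have "ennreal \<bar>a\<bar> * N1_norm N u \<le> ennreal \<bar>a\<bar> * (ennreal \<bar>1 / a\<bar> * N1_norm N (fun_scale a u))"
    by (rule mult_left_mono) simp
  also have "\<dots> = N1_norm N (fun_scale a u)"
    using False by (simp add: mult.assoc[symmetric] flip: ennreal_mult abs_mult)
  finally show ?thesis
    using le by (rule antisym[rotated])
qed

subsection \<open>Exceptional sets\<close>

text \<open>Null sets for which the curves with an end in \<open>S\<close> have modulus zero with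
  respect to the lattice: the multiples \<open>G / n\<close> are admissible for this family and
  their norms tend to 0. Only ends of curves matter, as in the upper gradient inequality.\<close>

definition exceptional :: "'a set \<Rightarrow> bool" where
  "exceptional S \<longleftrightarrow> (AE x in M. x \<notin> S) \<and>
    (\<exists>G\<in>borel_measurable borel. lattice_norm G < \<infinity> \<and>
      (\<forall>l \<gamma>. arc_length_curve l \<gamma> \<longrightarrow> \<gamma> 0 \<in> S \<or> \<gamma> l \<in> S \<longrightarrow> curve_integral G l \<gamma> = \<infinity>))"

text \<open>The sum of the witnesses serves for the union. Unions arise because an algebraic
  identity can fail where any one of the functions involved is infinite.\<close>

lemma exceptional_Un:
  assumes "exceptional S" "exceptional T"
  shows "exceptional (S \<union> T)"
proof -
  obtain G where G: "G \<in> borel_measurable borel" "lattice_norm G < \<infinity>"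
    "\<And>l \<gamma>. arc_length_curve l \<gamma> \<Longrightarrow> \<gamma> 0 \<in> S \<or> \<gamma> l \<in> S \<Longrightarrow> curve_integral G l \<gamma> = \<infinity>"
    using assms(1) unfolding exceptional_def by metis
  obtain H where H: "H \<in> borel_measurable borel" "lattice_norm H < \<infinity>"
    "\<And>l \<gamma>. arc_length_curve l \<gamma> \<Longrightarrow> \<gamma> 0 \<in> T \<or> \<gamma> l \<in> T \<Longrightarrow> curve_integral H l \<gamma> = \<infinity>"
    using assms(2) unfolding exceptional_def by metis
  have "AE x in M. x \<notin> S \<union> T"
    using assms by (auto simp: exceptional_def)
  moreover have "lattice_norm (\<lambda>x. G x + H x) < \<infinity>"
    using lattice_norm_add[OF G(1) H(1)] G(2) H(2)
    by (auto intro: le_less_trans simp: ennreal_mult_less_top)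
  moreover have "curve_integral (\<lambda>x. G x + H x) l \<gamma> = \<infinity>"
    if "arc_length_curve l \<gamma>" "\<gamma> 0 \<in> S \<union> T \<or> \<gamma> l \<in> S \<union> T" for l \<gamma>
    using that G(3)[OF that(1)] H(3)[OF that(1)]
    by (auto simp: curve_integral_add[OF that(1) G(1) H(1)])
  moreover have "(\<lambda>x. G x + H x) \<in> borel_measurable borel"
    using G(1) H(1) by measurable
  ultimately show ?thesis
    unfolding exceptional_def by (intro conjI bexI[of _ "\<lambda>x. G x + H x"]) auto
qed

lemma AE_finite:
  assumes [measurable]: "u \<in> borel_measurable M" and fin: "N u < \<infinity>"
  shows "AE x in M. \<bar>u x\<bar> \<noteq> \<infinity>"
proof -
  \<comment> \<open>The function \<infinity> on \<open>{\<bar>u\<bar> = \<infinity>}\<close> and 0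
    elsewhere is invariant under doubling, so \<open>N w\<close> is 0 or \<infinity>; the bound by
    \<open>N u\<close> excludes \<infinity>.\<close>
  define w where "w x = (if \<bar>u x\<bar> = \<infinity> then \<infinity> else 0 :: ereal)" for x
  have [measurable]: "w \<in> borel_measurable M"
    unfolding w_def by measurable
  have "fun_scale 2 w = w"
    by (auto simp: fun_scale_def w_def)
  then have "N w = 2 * N w"
    using N_scale[of w 2] by simp
  moreover have "N w \<le> N u"
    by (intro N_mono AE_I2) (auto simp: w_def)
  ultimately have "N w = 0"
    using fin by (cases "N w") (auto simp: top_unique simp flip: ennreal_mult ennreal_numeral)
  then have "AE x in M. w x = 0"
    by (simp add: N_eq_0_iff)
  then show ?thesis
    by eventually_elim (auto simp: w_def split: if_splits)
qed

text \<open>An upper gradient of finite norm is itself the witness \<open>G\<close>.\<close>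

lemma exceptional_infinite:
  assumes "u \<in> N1_space M N"
  shows "exceptional {x. \<bar>u x\<bar> = \<infinity>}"
proof -
  have u: "u \<in> borel_measurable M" "N1_norm N u < \<infinity>"
    using assms by (auto simp: N1_space_def)
  obtain g where g: "upper_gradient g u" "lattice_norm g < \<infinity>"
    using N1_norm_finite_obtain[OF u(2)] .
  have "curve_integral g l \<gamma> = \<infinity>"
    if \<gamma>: "arc_length_curve l \<gamma>" "\<gamma> 0 \<in> {x. \<bar>u x\<bar> = \<infinity>} \<or> \<gamma> l \<in> {x. \<bar>u x\<bar> = \<infinity>}" for l \<gamma>
  proof -
    have "ext_dist (u (\<gamma> 0)) (u (\<gamma> l)) \<le> curve_integral g l \<gamma>"
      using g(1) \<gamma>(1) by (simp add: upper_gradient_def)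
    moreover have "ext_dist (u (\<gamma> 0)) (u (\<gamma> l)) = \<infinity>"
      using \<gamma>(2) by (intro ext_dist_infinite) simp
    ultimately show ?thesis
      by (simp add: top_unique)
  qed
  then show ?thesis
    using g AE_finite[OF u(1)] N_le_N1_norm[of u] u(2)
    by (auto simp: exceptional_def upper_gradient_def intro!: bexI[of _ g])
qed

text \<open>Continuity of \<open>N\<close> avoids the factor \<open>c\<close> that subadditivity would give here.\<close>

lemma N1_norm_le_approx:
  assumes [measurable]: "u \<in> borel_measurable M" "v \<in> borel_measurable M"
    and AE: "AE x in M. u x = v x"
    and k [measurable]: "\<And>n. k n \<in> borel_measurable borel"
    and lim: "(\<lambda>n::nat. lattice_norm (k n)) \<longlonglongrightarrow> 0"
    and grad: "\<And>h n. upper_gradient h v \<Longrightarrow> upper_gradient (\<lambda>x. h x + k n x) u"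
  shows "N1_norm N u \<le> N1_norm N v"
proof -
  have "N u \<le> N v"
    using AE by (intro N_mono) auto
  moreover have "(INF g \<in> {g. upper_gradient g u}. lattice_norm g) \<le> lattice_norm h"
    if h: "upper_gradient h v" for h
  proof -
    have hm [measurable]: "h \<in> borel_measurable borel"
      using h by (simp add: upper_gradient_def)
    have m: "(\<lambda>x. enn2ereal (h x + k n x)) \<in> borel_measurable M" "(\<lambda>x. enn2ereal (h x)) \<in> borel_measurable M"
        "(\<lambda>x. enn2ereal (k n x)) \<in> borel_measurable M" for n
      by (intro measurable_enn2ereal_borel; measurable)+
    \<comment> \<open>The perturbed gradients converge to \<open>h\<close> in the lattice, so their
      norms, each an upper bound for the infimum belonging to \<open>u\<close>, converge to that of
      \<open>h\<close>.\<close>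
    have "N (fun_diff (\<lambda>x. enn2ereal (h x + k n x)) (\<lambda>x. enn2ereal (h x))) \<le> lattice_norm (k n)" for n
      by (intro N_mono measurable_fun_diff m AE_I2 abs_diff_enn2ereal_le)
    then have "(\<lambda>n. N (fun_diff (\<lambda>x. enn2ereal (h x + k n x)) (\<lambda>x. enn2ereal (h x)))) \<longlonglongrightarrow> 0"
      by (intro tendsto_sandwich[OF _ _ tendsto_const lim]) auto
    then have "(\<lambda>n. lattice_norm (\<lambda>x. h x + k n x)) \<longlonglongrightarrow> lattice_norm h"
      by (intro N_continuous m)
    then show ?thesis
      by (rule LIMSEQ_le_const) (auto intro!: INF_lower grad h)
  qed
  ultimately show ?thesis
    unfolding N1_norm_def by (intro add_mono INF_greatest) auto
qed

lemma N1_norm_le_off_exceptional: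
  assumes "u \<in> borel_measurable M" "v \<in> borel_measurable M"
    and S: "exceptional S" and eq: "\<And>x. x \<notin> S \<Longrightarrow> u x = v x"
  shows "N1_norm N u \<le> N1_norm N v"
proof -
  obtain G where G: "G \<in> borel_measurable borel" "lattice_norm G < \<infinity>"
    "\<And>l \<gamma>. arc_length_curve l \<gamma> \<Longrightarrow> \<gamma> 0 \<in> S \<or> \<gamma> l \<in> S \<Longrightarrow> curve_integral G l \<gamma> = \<infinity>"
    using S unfolding exceptional_def by metis
  obtain r where r: "lattice_norm G = ennreal r" "0 \<le> r"
    using G(2) by (cases "lattice_norm G") auto
  \<comment> \<open>Dividing by \<open>n + 1\<close> sends the norms to 0 but leaves the integral
    infinite on every curve with an end in \<open>S\<close>.\<close>
  define k where "k n = (\<lambda>x. ennreal (1 / real (Suc n)) * G x)" for n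
  have k: "k n \<in> borel_measurable borel" for n
    unfolding k_def using G(1) by measurable
  have "(\<lambda>n. 1 / real (Suc n) * r) \<longlonglongrightarrow> 0 * r"
    by (intro tendsto_mult tendsto_const LIMSEQ_Suc[OF lim_1_over_n])
  then have "(\<lambda>n. ennreal (1 / real (Suc n) * r)) \<longlonglongrightarrow> ennreal 0"
    by (intro tendsto_ennrealI) simp
  also have "(\<lambda>n. ennreal (1 / real (Suc n) * r)) = (\<lambda>n. lattice_norm (k n))"
    unfolding k_def by (subst lattice_norm_cmult[OF G(1)]) (auto simp: r simp flip: ennreal_mult)
  finally have lim: "(\<lambda>n. lattice_norm (k n)) \<longlonglongrightarrow> 0"
    by simp
  have "upper_gradient (\<lambda>x. h x + k n x) u" if h: "upper_gradient h v" for h n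
    unfolding upper_gradient_def
  proof (intro conjI allI impI)
    have hm: "h \<in> borel_measurable borel"
      using h by (simp add: upper_gradient_def)
    then show "(\<lambda>x. h x + k n x) \<in> borel_measurable borel"
      using k by measurable
    fix l and \<gamma> :: "real \<Rightarrow> 'a" assume \<gamma>: "arc_length_curve l \<gamma>"
    show "ext_dist (u (\<gamma> 0)) (u (\<gamma> l)) \<le> curve_integral (\<lambda>x. h x + k n x) l \<gamma>"
    proof (cases "\<gamma> 0 \<in> S \<or> \<gamma> l \<in> S")
      case True
      have "curve_integral (k n) l \<gamma> = \<infinity>"
        unfolding k_def using G(3)[OF \<gamma> True]
        by (simp add: curve_integral_cmult[OF \<gamma> G(1)] ennreal_mult_top)
      then show ?thesis
        by (simp add: curve_integral_add[OF \<gamma> hm k])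
    next
      case False
      then have "ext_dist (u (\<gamma> 0)) (u (\<gamma> l)) \<le> curve_integral h l \<gamma>"
        using h \<gamma> by (simp add: eq upper_gradient_def)
      also have "\<dots> \<le> curve_integral (\<lambda>x. h x + k n x) l \<gamma>"
        by (simp add: curve_integral_add[OF \<gamma> hm k])
      finally show ?thesis .
    qed
  qed
  moreover have "AE x in M. u x = v x"
    using S eq by (auto simp: exceptional_def)
  ultimately show ?thesis
    using assms(1,2) k lim by (intro N1_norm_le_approx[of u v k])
qed

lemma N1_norm_cong_off_exceptional:
  assumes "u \<in> borel_measurable M" "v \<in> borel_measurable M"
    and "exceptional S" and "\<And>x. x \<notin> S \<Longrightarrow> u x = v x"
  shows "N1_norm N u = N1_norm N v"
  using assms by (intro antisym N1_norm_le_off_exceptional) auto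

text \<open>Here the vanishing perturbations are minimizing upper gradients of \<open>f\<close>. The
  bound has no factor \<open>c\<close>, unlike the one from \<open>N1_norm_add\<close>.\<close>

lemma N1_norm_add_null_le:
  assumes [measurable]: "v \<in> borel_measurable M" "f \<in> borel_measurable M"
    and f: "N1_norm N f = 0"
  shows "N1_norm N (fun_add v f) \<le> N1_norm N v"
proof -
  have N0: "N f = 0"
    using f by (simp add: N1_norm_def)
  obtain k where k: "\<And>n. upper_gradient (k n) f" and "(\<lambda>n. N f + lattice_norm (k n)) \<longlonglongrightarrow> N1_norm N f"
    using minimizing_gradients[of f] f by auto
  then have "(\<lambda>n. lattice_norm (k n)) \<longlonglongrightarrow> 0"
    by (simp add: f N0)
  moreover have "AE x in M. fun_add v f x = v x"
    using N0 by (auto simp: N_eq_0_iff fun_add_def ext_add_def)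
  moreover have "k n \<in> borel_measurable borel" for n
    using k[of n] by (simp add: upper_gradient_def)
  ultimately show ?thesis
    using upper_gradient_add[OF _ k] by (intro N1_norm_le_approx[of _ v k]) auto
qed

subsection \<open>The quotient space\<close>

lemma N1_space_measurable: "u \<in> N1_space M N \<Longrightarrow> u \<in> borel_measurable M"
  by (simp add: N1_space_def)

lemma N1_space_add: "u \<in> N1_space M N \<Longrightarrow> v \<in> N1_space M N \<Longrightarrow> fun_add u v \<in> N1_space M N"
  using N1_norm_add[of u v]
  by (auto simp: N1_space_def intro: le_less_trans simp: ennreal_mult_less_top)

lemma N1_space_scale: "u \<in> N1_space M N \<Longrightarrow> fun_scale a u \<in> N1_space M N"
  by (auto simp: N1_space_def N1_norm_scale ennreal_mult_less_top)

lemma N1_space_diff: "u \<in> N1_space M N \<Longrightarrow> v \<in> N1_space M N \<Longrightarrow> fun_diff u v \<in> N1_space M N"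
  unfolding fun_diff_def by (intro N1_space_add N1_space_scale)

lemma N1_space_zero: "(\<lambda>x. 0) \<in> N1_space M N"
  by (simp add: N1_space_def N1_norm_zero)

lemma N1_norm_null_add:
  assumes f: "f \<in> N1_space M N" "N1_norm N f = 0" and g: "g \<in> N1_space M N" "N1_norm N g = 0"
  shows "N1_norm N (fun_add f g) = 0"
  using N1_norm_add_null_le[of f g] f g by (simp add: N1_space_measurable)

lemma N1_relI_off_exceptional:
  assumes "u \<in> N1_space M N" "v \<in> N1_space M N" "exceptional S" "\<And>x. x \<notin> S \<Longrightarrow> u x = v x"
  shows "(u, v) \<in> N1_rel M N"
proof -
  \<comment> \<open>Off \<open>S\<close> the difference agrees with \<open>fun_diff u u\<close>,
    which is 0 even at infinite values.\<close>
  have "N1_norm N (fun_diff u v) = N1_norm N (fun_diff u u)"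
    using assms
    by (intro N1_norm_cong_off_exceptional[of _ _ S] measurable_fun_diff N1_space_measurable)
       (auto simp: fun_diff_def fun_add_def fun_scale_def)
  then show ?thesis
    using assms by (simp add: N1_rel_def fun_diff_self N1_norm_zero)
qed

lemma N1_rel_sym: "(u, v) \<in> N1_rel M N \<Longrightarrow> (v, u) \<in> N1_rel M N"
  using N1_norm_scale[of "fun_diff u v" "- 1"] N1_space_diff[of u v]
  by (auto simp: N1_rel_def fun_diff_swap N1_space_def)

lemma N1_rel_trans:
  assumes uv: "(u, v) \<in> N1_rel M N" and vw: "(v, w) \<in> N1_rel M N"
  shows "(u, w) \<in> N1_rel M N"
proof -
  have sp: "u \<in> N1_space M N" "v \<in> N1_space M N" "w \<in> N1_space M N"
    and z: "N1_norm N (fun_diff u v) = 0" "N1_norm N (fun_diff v w) = 0"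
    using assms by (auto simp: N1_rel_def)
  \<comment> \<open>Telescoping through \<open>v\<close> needs finite values: for
    \<open>u x = 0\<close>, \<open>v x = \<infinity>\<close>, \<open>w x = 1\<close> the left side
    is -1 and the right side is 0.\<close>
  let ?S = "{x. \<bar>u x\<bar> = \<infinity>} \<union> ({x. \<bar>v x\<bar> = \<infinity>} \<union> {x. \<bar>w x\<bar> = \<infinity>})"
  have "N1_norm N (fun_diff u w) = N1_norm N (fun_add (fun_diff u v) (fun_diff v w))"
  proof (intro N1_norm_cong_off_exceptional[of _ _ ?S])
    show "exceptional ?S"
      by (intro exceptional_Un exceptional_infinite sp)
    show "fun_diff u w x = fun_add (fun_diff u v) (fun_diff v w) x" if "x \<notin> ?S" for x
      using that by (auto simp: fun_diff_def fun_add_def fun_scale_def ext_add_def)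
  qed (intro N1_space_measurable N1_space_add N1_space_diff sp)+
  also have "\<dots> = 0"
    by (intro N1_norm_null_add N1_space_diff sp z)
  finally show ?thesis
    using sp by (simp add: N1_rel_def)
qed

lemma N1_rel_equiv: "equiv (N1_space M N) (N1_rel M N)"
proof (rule equivI)
  show "N1_rel M N \<subseteq> N1_space M N \<times> N1_space M N"
    by (auto simp: N1_rel_def)
  show "refl_on (N1_space M N) (N1_rel M N)"
    by (auto simp: refl_on_def N1_rel_def fun_diff_self N1_norm_zero)
  show "sym (N1_rel M N)"
    by (auto intro: symI N1_rel_sym)
  show "trans (N1_rel M N)"
    by (auto intro: transI N1_rel_trans)
qed

text \<open>Off the infinite values, \<open>u\<close> is \<open>v\<close> plus the null function
  \<open>fun_diff u v\<close>. Since adding a null function costs no factor \<open>c\<close>,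
  symmetry makes the norm constant on classes even when \<open>c > 1\<close>.\<close>

lemma N1_norm_le_rel:
  assumes "(u, v) \<in> N1_rel M N"
  shows "N1_norm N u \<le> N1_norm N v"
proof -
  have sp: "u \<in> N1_space M N" "v \<in> N1_space M N" and z: "N1_norm N (fun_diff u v) = 0"
    using assms by (auto simp: N1_rel_def)
  let ?S = "{x. \<bar>u x\<bar> = \<infinity>} \<union> {x. \<bar>v x\<bar> = \<infinity>}"
  have "N1_norm N u = N1_norm N (fun_add v (fun_diff u v))"
  proof (intro N1_norm_cong_off_exceptional[of _ _ ?S])
    show "exceptional ?S"
      by (intro exceptional_Un exceptional_infinite sp)
    show "u x = fun_add v (fun_diff u v) x" if "x \<notin> ?S" for x
      using that by (auto simp: fun_diff_def fun_add_def fun_scale_def ext_add_def)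
  qed (intro N1_space_measurable N1_space_add N1_space_diff sp)+
  also have "\<dots> \<le> N1_norm N v"
    by (intro N1_norm_add_null_le z N1_space_measurable N1_space_diff sp)
  finally show ?thesis .
qed

lemma N1_norm_respects: "N1_norm N respects N1_rel M N"
  by (intro congruentI antisym N1_norm_le_rel) (auto intro: N1_rel_sym)

lemma N1_rel_add:
  assumes "(u, u') \<in> N1_rel M N" "(v, v') \<in> N1_rel M N"
  shows "(fun_add u v, fun_add u' v') \<in> N1_rel M N"
proof -
  have sp: "u \<in> N1_space M N" "u' \<in> N1_space M N" "v \<in> N1_space M N" "v' \<in> N1_space M N"
    and z: "N1_norm N (fun_diff u u') = 0" "N1_norm N (fun_diff v v') = 0"
    using assms by (auto simp: N1_rel_def)
  \<comment> \<open>Where all four functions are finite, the difference of the sums can be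
    rearranged into the sum of two null differences.\<close>
  let ?S = "({x. \<bar>u x\<bar> = \<infinity>} \<union> {x. \<bar>u' x\<bar> = \<infinity>}) \<union> ({x. \<bar>v x\<bar> = \<infinity>} \<union> {x. \<bar>v' x\<bar> = \<infinity>})"
  have "N1_norm N (fun_diff (fun_add u v) (fun_add u' v'))
      = N1_norm N (fun_add (fun_diff u u') (fun_diff v v'))"
  proof (intro N1_norm_cong_off_exceptional[of _ _ ?S])
    show "exceptional ?S"
      by (intro exceptional_Un exceptional_infinite sp)
    show "fun_diff (fun_add u v) (fun_add u' v') x = fun_add (fun_diff u u') (fun_diff v v') x"
      if "x \<notin> ?S" for x
      using that by (auto simp: fun_diff_def fun_add_def fun_scale_def ext_add_def)
  qed (intro N1_space_measurable N1_space_add N1_space_diff sp)+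
  also have "\<dots> = 0"
    by (intro N1_norm_null_add N1_space_diff sp z)
  finally show ?thesis
    using sp by (simp add: N1_rel_def N1_space_add)
qed

lemma N1_rel_scale: "(u, v) \<in> N1_rel M N \<Longrightarrow> (fun_scale a u, fun_scale a v) \<in> N1_rel M N"
  using N1_norm_scale[of "fun_diff u v" a] N1_space_diff[of u v]
  by (simp add: N1_rel_def N1_space_scale fun_scale_diff) (simp add: N1_space_def)

section \<open>Operations, vector space structure and norm on classes\<close>

lemma N1_class_eqI: "(u, v) \<in> N1_rel M N \<Longrightarrow> N1_class M N u = N1_class M N v"
  unfolding N1_class_def by (rule equiv_class_eq[OF N1_rel_equiv])

lemma N1_class_add_respects2: "(\<lambda>u v. N1_class M N (fun_add u v)) respects2 N1_rel M N"
  by (intro congruent2I' N1_class_eqI N1_rel_add)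

lemma N1_class_scale_respects: "(\<lambda>u. N1_class M N (fun_scale a u)) respects N1_rel M N"
  by (intro congruentI N1_class_eqI N1_rel_scale)

lemma N1_quotient_add_class:
  "u \<in> N1_space M N \<Longrightarrow> v \<in> N1_space M N \<Longrightarrow>
    N1_quotient_add M N (N1_class M N u) (N1_class M N v) = N1_class M N (fun_add u v)"
  using UN_equiv_class2[OF N1_rel_equiv N1_rel_equiv N1_class_add_respects2]
  by (simp add: N1_quotient_add_def N1_class_def)

lemma N1_quotient_scale_class:
  "u \<in> N1_space M N \<Longrightarrow> N1_quotient_scale M N a (N1_class M N u) = N1_class M N (fun_scale a u)"
  using UN_equiv_class[OF N1_rel_equiv N1_class_scale_respects]
  by (simp add: N1_quotient_scale_def N1_class_def)

lemma N1_quotient_norm_class: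
  assumes "u \<in> N1_space M N"
  shows "N1_quotient_norm N (N1_class M N u) = N1_norm N u"
proof -
  \<comment> \<open>A nonempty class with constant norm has a singleton image, which gives
    \<open>the_elem\<close> its meaning.\<close>
  have "N1_class M N u \<noteq> {}"
    using equiv_class_self[OF N1_rel_equiv assms] by (auto simp: N1_class_def)
  moreover have "N1_norm N ` N1_class M N u = (\<lambda>_. N1_norm N u) ` N1_class M N u"
    using congruentD[OF N1_norm_respects] by (intro image_cong) (auto simp: N1_class_def)
  ultimately have "N1_norm N ` N1_class M N u = {N1_norm N u}"
    by (simp add: image_constant_conv)
  then show ?thesis
    by (simp add: N1_quotient_norm_def)
qed

lemma N1_quotient_eq: "N1_quotient M N = N1_class M N ` N1_space M N"
  by (auto simp: N1_quotient_def quotient_def N1_class_def)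

lemma N1_quotient_vector_space:
  "real_vector_space_on (N1_quotient M N) (N1_quotient_add M N) (N1_quotient_scale M N)
    (N1_class M N (\<lambda>x. 0))"
proof -
  \<comment> \<open>Pointwise associativity can fail: (\<infinity> + (-\<infinity>)) + 1 is 1, but
    \<infinity> + (-\<infinity> + 1) is 0. It holds off an exceptional set, hence for
    classes.\<close>
  have assoc: "N1_class M N (fun_add (fun_add u v) w) = N1_class M N (fun_add u (fun_add v w))"
    if sp: "u \<in> N1_space M N" "v \<in> N1_space M N" "w \<in> N1_space M N" for u v w
  proof (intro N1_class_eqI N1_relI_off_exceptional N1_space_add sp)
    let ?S = "{x. \<bar>u x\<bar> = \<infinity>} \<union> ({x. \<bar>v x\<bar> = \<infinity>} \<union> {x. \<bar>w x\<bar> = \<infinity>})"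
    show "exceptional ?S"
      by (intro exceptional_Un exceptional_infinite sp)
    show "fun_add (fun_add u v) w x = fun_add u (fun_add v w) x" if "x \<notin> ?S" for x
      using that by (auto simp: fun_add_def ext_add_def add.assoc)
  qed
  have distrib: "N1_class M N (fun_scale a (fun_add u v))
      = N1_class M N (fun_add (fun_scale a u) (fun_scale a v))"
    if sp: "u \<in> N1_space M N" "v \<in> N1_space M N" for a u v
  proof (intro N1_class_eqI N1_relI_off_exceptional N1_space_add N1_space_scale sp)
    let ?S = "{x. \<bar>u x\<bar> = \<infinity>} \<union> {x. \<bar>v x\<bar> = \<infinity>}"
    show "exceptional ?S"
      by (intro exceptional_Un exceptional_infinite sp)
    show "fun_scale a (fun_add u v) x = fun_add (fun_scale a u) (fun_scale a v) x"
      if "x \<notin> ?S" for x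
      using that by (auto simp: fun_add_def fun_scale_def ext_add_def algebra_simps)
  qed
  \<comment> \<open>At an infinite value this can fail pointwise: for \<open>a = 2\<close>,
    \<open>b = -1\<close> and the value \<infinity>, the left side is \<infinity> and the right side
    is 0.\<close>
  have distrib': "N1_class M N (fun_scale (a + b) u)
      = N1_class M N (fun_add (fun_scale a u) (fun_scale b u))"
    if sp: "u \<in> N1_space M N" for a b u
  proof (intro N1_class_eqI N1_relI_off_exceptional N1_space_add N1_space_scale sp)
    show "exceptional {x. \<bar>u x\<bar> = \<infinity>}"
      by (intro exceptional_infinite sp)
    show "fun_scale (a + b) u x = fun_add (fun_scale a u) (fun_scale b u) x"
      if "x \<notin> {x. \<bar>u x\<bar> = \<infinity>}" for x
      using that by (auto simp: fun_add_def fun_scale_def ext_add_def algebra_simps)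
  qed
  \<comment> \<open>The convention \<infinity> - \<infinity> = 0 makes this exact at every point, so
    \<open>fun_scale (- 1) u\<close> represents the additive inverse.\<close>
  have neg: "fun_add u (fun_scale (- 1) u) = (\<lambda>x. 0)" for u :: "'a \<Rightarrow> ereal"
    using fun_diff_self[of u] by (simp add: fun_diff_def)
  have zero: "fun_add (\<lambda>x. 0) u = u" for u :: "'a \<Rightarrow> ereal"
    by (simp add: fun_add_def ext_add_def)
  have inverse: "\<exists>v\<in>N1_space M N. N1_class M N (fun_add u v) = N1_class M N (\<lambda>x. 0)"
    if "u \<in> N1_space M N" for u
    using N1_space_scale[OF that, of "- 1"] neg[of u] by (intro bexI[of _ "fun_scale (- 1) u"]) auto
  show ?thesis
    unfolding real_vector_space_on_def N1_quotient_eq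
    using inverse
    by (simp add: N1_quotient_add_class N1_quotient_scale_class N1_space_add N1_space_scale
        N1_space_zero assoc distrib distrib' zero fun_scale_scale fun_scale_one)
       (metis fun_add_commute)
qed

lemma N1_quasi_seminorm: "quasi_seminorm_on c (N1_space M N) fun_add fun_scale (N1_norm N)"
  unfolding quasi_seminorm_on_def
  by (auto simp: modulus_ge_1 N1_space_add N1_space_scale intro: N1_norm_add N1_norm_scale)
     (auto simp: N1_space_def intro: N1_norm_add N1_norm_scale)

lemma N1_quasi_norm:
  "quasi_norm_on c (N1_quotient M N) (N1_quotient_add M N) (N1_quotient_scale M N)
    (N1_class M N (\<lambda>x. 0)) (N1_quotient_norm N)"
proof -
  \<comment> \<open>Definiteness: since \<open>fun_diff u (\<lambda>x. 0)\<close> is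
    \<open>u\<close>, a vanishing norm says that \<open>u\<close> is related to the zero
    function.\<close>
  have "N1_norm N u = 0 \<longleftrightarrow> N1_class M N u = N1_class M N (\<lambda>x. 0)" if "u \<in> N1_space M N" for u
  proof
    assume "N1_norm N u = 0"
    then show "N1_class M N u = N1_class M N (\<lambda>x. 0)"
      using that by (intro N1_class_eqI) (simp add: N1_rel_def fun_diff_zero N1_space_zero)
  next
    assume "N1_class M N u = N1_class M N (\<lambda>x. 0)"
    then have "N1_norm N u = N1_norm N (\<lambda>x. 0)"
      using that N1_quotient_norm_class N1_space_zero by metis
    then show "N1_norm N u = 0"
      by (simp add: N1_norm_zero)
  qed
  moreover have "quasi_seminorm_on c (N1_quotient M N) (N1_quotient_add M N)
      (N1_quotient_scale M N) (N1_quotient_norm N)"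
    using N1_quasi_seminorm unfolding quasi_seminorm_on_def N1_quotient_eq
    by (auto simp: N1_quotient_add_class N1_quotient_scale_class N1_quotient_norm_class)
  ultimately show ?thesis
    using N1_quotient_vector_space
    by (auto simp: quasi_norm_on_def N1_quotient_eq N1_quotient_norm_class)
qed

end

theorem proposition2p7:
  fixes M :: "'a::metric_space measure"
    and N :: "('a \<Rightarrow> ereal) \<Rightarrow> ennreal"
    and c :: real
  assumes "quasi_banach_function_lattice M N c"
  shows
    "(equiv (N1_space M N) (N1_rel M N) \<and>
      N1_norm N respects N1_rel M N \<and>
      (\<lambda>u v. N1_class M N (fun_add u v)) respects2 N1_rel M N \<and>
      (\<forall>a. (\<lambda>u. N1_class M N (fun_scale a u)) respects N1_rel M N)) \<and>
     (c = 1 \<longrightarrow>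
      seminorm_on (N1_space M N) fun_add fun_scale (N1_norm N) \<and>
      norm_on (N1_quotient M N) (N1_quotient_add M N) (N1_quotient_scale M N)
        (N1_class M N (\<lambda>x. 0)) (N1_quotient_norm N)) \<and>
     quasi_seminorm_on c (N1_space M N) fun_add fun_scale (N1_norm N) \<and>
     quasi_norm_on c (N1_quotient M N) (N1_quotient_add M N) (N1_quotient_scale M N)
       (N1_class M N (\<lambda>x. 0)) (N1_quotient_norm N) \<and>
     (\<forall>u\<in>N1_space M N. \<forall>v\<in>N1_space M N.
       N1_norm N (fun_add u v) \<le> ennreal c * (N1_norm N u + N1_norm N v))"
proof -
  interpret quasi_banach_function_lattice M N c
    by (rule assms)
  show ?thesis
    \<comment> \<open>For \<open>c = 1\<close> the seminorm and norm claims are the quasi-versions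
      with modulus 1.\<close>
    using N1_rel_equiv N1_norm_respects N1_class_add_respects2 N1_class_scale_respects
      N1_quasi_seminorm N1_quasi_norm
    by (auto simp: quasi_seminorm_on_def)
qed

end
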